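(* Let $s\ge 1$ be an integer and $e=(1,1,\ldots,1)^T\in\mathbb{R}^s$. Define $A_{\mathrm{opt}}\in\mathbb{R}^{s\times s}$ and $b_{\mathrm{opt}}\in\mathbb{R}^s$ by $$(A_{\mathrm{opt}})_{ij}=\begin{cases}\frac1s,& j<i,\\ \frac1{2s},& j=i,\\ 0,& j>i,\end{cases}\qquad (b_{\mathrm{opt}})_j=\frac1s\quad(1\le i,j\le s).$$ Consider pairs $(A,b)$ with $A\in\mathbb{R}^{s\times s}$ lower triangular and $b\in\mathbb{R}^s$ such that $b^Te=1$, $b^TAe=\frac12$, and such that for $r=2s$ the matrix $I+rA$ is invertible and, entrywise, $$(I+rA)^{-1}e\ge 0,\qquad rA(I+rA)^{-1}\ge 0,\qquad b^T(I+rA)^{-1}\ge 0,\qquad 1-r\,b^T(I+rA)^{-1}e\ge 0.$$ Then $(A,b)=(A_{\mathrm{opt}},b_{\mathrm{opt}})$ satisfies all these conditions, and it is the only such pair. Moreover, the Runge--Kutta method with coefficients $(A_{\mathrm{opt}},b_{\mathrm{opt}})$ and time step $\tau$ is the iterated implicit midpoint rule, i.e. the composition of $s$ steps of the implicit midpoint rule, each with time step $\tau/s$.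
   Context: An $s$-stage Runge--Kutta method with coefficients $(A,b)$, applied to $U'=f(U)$ with time step $\tau$, computes $U_{n+1}=U_n+\tau\sum_{j=1}^s b_jf(y_j)$, where the stage values satisfy $y_i=U_n+\tau\sum_{j=1}^s a_{ij}f(y_j)$ for $i=1,\ldots,s$. It is diagonally implicit when $A$ is lower triangular. The equalities $b^Te=1$, $b^TAe=\frac12$ are the conditions for order at least two. The implicit midpoint rule with time step $h$ is the one-stage method $y=U+\frac h2 f(y)$, $U_{\mathrm{new}}=U+hf(y)$. $I$ is the $s\times s$ identity matrix; inequalities are entrywise. *)

theory Defs
  imports Complex_Main "Jordan_Normal_Form.Gauss_Jordan_Elimination"
begin

(* Indices run over 0, ..., s - 1, as in the matrix library. *)

definition ones_vec :: "nat \<Rightarrow> real vec" where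
  "ones_vec s = vec s (\<lambda>_. 1)"

definition A_opt :: "nat \<Rightarrow> real mat" where
  "A_opt s = mat s s (\<lambda>(i, j).
     if j < i then 1 / real s else if j = i then 1 / (2 * real s) else 0)"

definition b_opt :: "nat \<Rightarrow> real vec" where
  "b_opt s = vec s (\<lambda>_. 1 / real s)"

definition lower_triangular_mat :: "real mat \<Rightarrow> bool" where
  "lower_triangular_mat A \<longleftrightarrow>
     (\<forall>i < dim_row A. \<forall>j < dim_col A. i < j \<longrightarrow> A $$ (i, j) = 0)"

(* mat_inverse returns None on singular matrices, so inv_mat M is meaningful
   only for invertible M. *)
definition inv_mat :: "real mat \<Rightarrow> real mat" where
  "inv_mat M = the (mat_inverse M)"

definition order_two :: "nat \<Rightarrow> real mat \<Rightarrow> real vec \<Rightarrow> bool" where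
  "order_two s A b \<longleftrightarrow>
     b \<bullet> ones_vec s = 1 \<and> b \<bullet> (A *\<^sub>v ones_vec s) = 1 / 2"

(* The orders on vec and mat are entrywise; the row vector b^T K is written as
   the column vector K^T b. *)
definition monotonicity_conditions :: "nat \<Rightarrow> real \<Rightarrow> real mat \<Rightarrow> real vec \<Rightarrow> bool" where
  "monotonicity_conditions s r A b \<longleftrightarrow>
     (let M = 1\<^sub>m s + r \<cdot>\<^sub>m A; K = inv_mat M in
        invertible_mat M \<and>
        0\<^sub>v s \<le> K *\<^sub>v ones_vec s \<and>
        0\<^sub>m s s \<le> (r \<cdot>\<^sub>m A) * K \<and>
        0\<^sub>v s \<le> transpose_mat K *\<^sub>v b \<and>
        0 \<le> 1 - r * (b \<bullet> (K *\<^sub>v ones_vec s)))"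

definition admissible :: "nat \<Rightarrow> real mat \<Rightarrow> real vec \<Rightarrow> bool" where
  "admissible s A b \<longleftrightarrow>
     A \<in> carrier_mat s s \<and> b \<in> carrier_vec s \<and> lower_triangular_mat A \<and>
     order_two s A b \<and> monotonicity_conditions s (2 * real s) A b"

(* The stage equations are implicit and, for general f, may have no solution or
   several; a step is therefore a relation between the old and the new value. *)
definition rk_step ::
  "nat \<Rightarrow> real mat \<Rightarrow> real vec \<Rightarrow> ('v::real_vector \<Rightarrow> 'v) \<Rightarrow> real \<Rightarrow> 'v \<Rightarrow> 'v \<Rightarrow> bool" where
  "rk_step s A b f \<tau> U U' \<longleftrightarrow>
     (\<exists>y :: nat \<Rightarrow> 'v.
        (\<forall>i<s. y i = U + \<tau> *\<^sub>R (\<Sum>j<s. A $$ (i, j) *\<^sub>R f (y j))) \<and>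
        U' = U + \<tau> *\<^sub>R (\<Sum>j<s. b $ j *\<^sub>R f (y j)))"

definition midpoint_step ::
  "('v::real_vector \<Rightarrow> 'v) \<Rightarrow> real \<Rightarrow> 'v \<Rightarrow> 'v \<Rightarrow> bool" where
  "midpoint_step f h U U' \<longleftrightarrow>
     (\<exists>y. y = U + (h / 2) *\<^sub>R f y \<and> U' = U + h *\<^sub>R f y)"

end

theory Submission
  imports Defs "Jordan_Normal_Form.Determinant"
begin

text \<open>
  Put \<open>N = I + 2 s A\<close>, \<open>K = N\<^sup>-\<^sup>1\<close>, \<open>x = N e\<close>, \<open>z = N x\<close> and \<open>w = K\<^sup>T b\<close>. The order conditions become
  \<open>w \<bullet> x = 1\<close> and \<open>w \<bullet> z = s + 1\<close>, and the last monotonicity condition says that the weights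
  \<open>u = 2 s w \<ge> 0\<close> have total mass at most 1. Reading \<open>K x = e\<close> and \<open>K z = x\<close> row by row
  gives \<open>x\<^sub>i = t\<^sub>i + \<Sum> q\<^sub>i\<^sub>j x\<^sub>j\<close> and \<open>z\<^sub>i = t\<^sub>i x\<^sub>i + \<Sum> q\<^sub>i\<^sub>j z\<^sub>j\<close> (sums over \<open>j < i\<close>) with
  \<open>t\<^sub>i = 1 / K\<^sub>i\<^sub>i\<close>, \<open>q\<^sub>i\<^sub>j = - K\<^sub>i\<^sub>j / K\<^sub>i\<^sub>i \<ge> 0\<close> and \<open>\<Sum> q\<^sub>i\<^sub>j \<le> 1\<close>. Jensen's inequality and a minimisation over \<open>t\<^sub>i\<close>
  show inductively that the \<open>i\<close>-th stage (counted from 1) satisfies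
  \<open>z\<^sub>i \<ge> (i + 1) / (2 i) \<cdot> x\<^sub>i\<^sup>2\<close>. One more use of Jensen's inequality, with the weights \<open>u\<close>, yields
  \<open>u \<bullet> z \<ge> 2 s (s + 1)\<close>. The order conditions force equality, and the equality cases determine
  \<open>w\<close> and, from the last stage down to the first, every row of \<open>K\<close>.
\<close>

section \<open>Jensen's inequality with decreasing growth factors, and its equality case\<close>

definition growth :: "nat \<Rightarrow> real" where
  "growth n = (real n + 1) / (2 * real n)"

lemma growth_pos: "n > 0 \<Longrightarrow> growth n > 0"
  by (simp add: growth_def)

lemma growth_strict_antimono: "0 < m \<Longrightarrow> m < n \<Longrightarrow> growth n < growth m"
  by (simp add: growth_def field_simps)

lemma growth_antimono: "0 < m \<Longrightarrow> m \<le> n \<Longrightarrow> growth n \<le> growth m"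
  using growth_strict_antimono[of m n] by (cases "m = n") auto

text \<open>In the extremal configuration the \<open>n\<close>-th stage, counted from 1, has x-value
  \<open>2 n\<close> and z-value \<open>2 n (n + 1)\<close>. These values lie exactly on the lower
  bound.\<close>

lemma growth_double: "growth n * (2 * real n)\<^sup>2 = 2 * real n * (real n + 1)"
  by (cases "n = 0") (simp_all add: growth_def power2_eq_square field_simps)

text \<open>Instantiated twice: with the row \<open>q i\<close> of a stage recursion, and with the
  outer weights \<open>2 s w\<close>.\<close>

locale subconvex_combination =
  fixes n :: nat and q x z :: "nat \<Rightarrow> real"
  assumes q_nonneg: "j < n \<Longrightarrow> q j \<ge> 0"
    and q_sum: "(\<Sum>j<n. q j) \<le> 1"
    and x_pos: "j < n \<Longrightarrow> x j > 0"
    and z_ge: "j < n \<Longrightarrow> growth (Suc j) * (x j)\<^sup>2 \<le> z j"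
begin

abbreviation mean :: real where
  "mean \<equiv> \<Sum>j<n. q j * x j"

text \<open>Separates the three sources of slack in Jensen's inequality: slack at the individual
  points, the spread of \<open>x\<close> about its mean, and the missing mass of the weights. Each
  is nonnegative, so equality makes all three vanish.\<close>

lemma excess_decomposition:
  "(\<Sum>j<n. q j * z j) - growth n * mean\<^sup>2 =
    (\<Sum>j<n. q j * (z j - growth n * (x j)\<^sup>2))
      + growth n * (\<Sum>j<n. q j * (x j - mean)\<^sup>2)
      + growth n * (mean\<^sup>2 * (1 - (\<Sum>j<n. q j)))"
proof -
  have "(\<Sum>j<n. q j * (x j - m)\<^sup>2) =
      (\<Sum>j<n. q j * (x j)\<^sup>2) - 2 * m * mean + m\<^sup>2 * (\<Sum>j<n. q j)" for m
    by (simp add: power2_diff algebra_simps sum.distrib sum_subtractf sum_distrib_left flip: sum_distrib_right)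
  from this[of mean] have second: "(\<Sum>j<n. q j * (x j - mean)\<^sup>2) =
      (\<Sum>j<n. q j * (x j)\<^sup>2) - mean\<^sup>2 * (2 - (\<Sum>j<n. q j))"
    by (simp add: algebra_simps power2_eq_square)
  have first: "(\<Sum>j<n. q j * (z j - growth n * (x j)\<^sup>2)) =
      (\<Sum>j<n. q j * z j) - growth n * (\<Sum>j<n. q j * (x j)\<^sup>2)"
    by (simp add: algebra_simps sum_subtractf sum_distrib_left)
  show ?thesis unfolding first second by (simp add: algebra_simps)
qed

lemma growth_nonneg: "growth n \<ge> 0"
  by (simp add: growth_def)

lemma z_excess_nonneg: "j < n \<Longrightarrow> 0 \<le> q j * (z j - growth n * (x j)\<^sup>2)"
proof -
  assume j: "j < n"
  have "growth n * (x j)\<^sup>2 \<le> growth (Suc j) * (x j)\<^sup>2"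
    using growth_antimono[of "Suc j" n] j by (intro mult_right_mono) auto
  with z_ge[OF j] q_nonneg[OF j] show ?thesis by (intro mult_nonneg_nonneg) linarith+
qed

lemma excess_terms_nonneg:
  "0 \<le> (\<Sum>j<n. q j * (z j - growth n * (x j)\<^sup>2))"
  "0 \<le> growth n * (\<Sum>j<n. q j * (x j - mean)\<^sup>2)"
  "0 \<le> growth n * (mean\<^sup>2 * (1 - (\<Sum>j<n. q j)))"
proof -
  show "0 \<le> (\<Sum>j<n. q j * (z j - growth n * (x j)\<^sup>2))"
    by (intro sum_nonneg z_excess_nonneg) simp
qed (use q_nonneg q_sum growth_nonneg in \<open>auto intro!: sum_nonneg mult_nonneg_nonneg\<close>)

lemma mean_bound: "growth n * mean\<^sup>2 \<le> (\<Sum>j<n. q j * z j)"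
  using excess_decomposition excess_terms_nonneg by linarith

text \<open>A positive mean forces total mass 1. As \<open>growth\<close> is strictly decreasing,
  weight on any index below \<open>n - 1\<close> would leave slack, so the last index carries
  everything.\<close>

lemma equality_case:
  assumes eq: "(\<Sum>j<n. q j * z j) \<le> growth n * mean\<^sup>2" and m: "mean > 0" and j: "j < n"
  shows "q j = (if Suc j = n then 1 else 0)"
proof -
  have n: "n > 0" using j by simp
  have "(\<Sum>j<n. q j * (z j - growth n * (x j)\<^sup>2)) = 0"
    and "growth n * (mean\<^sup>2 * (1 - (\<Sum>j<n. q j))) = 0"
    using excess_decomposition excess_terms_nonneg eq by linarith+
  then have terms: "\<forall>j\<in>{..<n}. q j * (z j - growth n * (x j)\<^sup>2) = 0" and total: "(\<Sum>j<n. q j) = 1"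
    using growth_pos[OF n] m z_excess_nonneg
      sum_nonneg_eq_0_iff[of "{..<n}" "\<lambda>j. q j * (z j - growth n * (x j)\<^sup>2)"] by auto
  have zero: "q k = 0" if k: "Suc k < n" for k
  proof -
    have "growth n * (x k)\<^sup>2 < growth (Suc k) * (x k)\<^sup>2"
      using growth_strict_antimono[of "Suc k" n] k x_pos[of k] by (intro mult_strict_right_mono) auto
    with z_ge[of k] k terms show ?thesis by fastforce
  qed
  obtain k where k: "n = Suc k" using n by (cases n) auto
  have "(\<Sum>j<n. q j) = q k" using zero by (simp add: k)
  with total zero j k show ?thesis by auto
qed

end

section \<open>Lower bounds along the stage recursion and the rigidity of the extremal case\<close>

locale stage_recursion =
  fixes s :: nat and q :: "nat \<Rightarrow> nat \<Rightarrow> real" and t x z :: "nat \<Rightarrow> real"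
  assumes q_nonneg: "i < s \<Longrightarrow> j < i \<Longrightarrow> q i j \<ge> 0"
    and q_sum: "i < s \<Longrightarrow> (\<Sum>j<i. q i j) \<le> 1"
    and t_pos: "i < s \<Longrightarrow> t i > 0"
    and x_rec: "i < s \<Longrightarrow> x i = t i + (\<Sum>j<i. q i j * x j)"
    and z_rec: "i < s \<Longrightarrow> z i = t i * x i + (\<Sum>j<i. q i j * z j)"
begin

text \<open>For fixed \<open>x i\<close>, the right-hand side of the \<open>z\<close>-recursion is bounded below by a quadratic in
  \<open>t i\<close>, whose minimum is at \<open>t i = x i / (i + 1)\<close>. For \<open>i = 0\<close> the sums are empty and
  \<open>growth 0 = 0\<close> by division by zero.\<close>

lemma completed_square:
  assumes "i < s"
  shows "z i - growth (Suc i) * (x i)\<^sup>2 =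
    ((\<Sum>j<i. q i j * z j) - growth i * (\<Sum>j<i. q i j * x j)\<^sup>2)
      + growth i * (t i - x i / (real i + 1))\<^sup>2"
proof (cases "i = 0")
  case True
  then show ?thesis
    using x_rec[OF assms] z_rec[OF assms] by (simp add: growth_def power2_eq_square)
next
  case False
  have m: "(\<Sum>j<i. q i j * x j) = x i - t i" using x_rec[OF assms] by simp
  have "real i > 0" using False by simp
  then show ?thesis
    unfolding m z_rec[OF assms]
    by (simp add: growth_def power2_eq_square divide_simps) (simp add: algebra_simps)
qed

text \<open>Positivity and the bound are proved together because Jensen's inequality for row
  \<open>i\<close> needs both at all earlier stages.\<close>

lemma stage_bound:
  "i < s \<Longrightarrow> x i > 0 \<and> growth (Suc i) * (x i)\<^sup>2 \<le> z i"
proof (induction i rule: less_induct)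
  case (less i)
  interpret subconvex_combination i "q i" x z
    using less q_nonneg q_sum by unfold_locales auto
  have "(\<Sum>j<i. q i j * x j) \<ge> 0"
    using less by (intro sum_nonneg mult_nonneg_nonneg) (auto simp: q_nonneg less_imp_le)
  then have "x i > 0" using x_rec[OF less.prems] t_pos[OF less.prems] by simp
  moreover have "0 \<le> growth i * (t i - x i / (real i + 1))\<^sup>2"
    using growth_nonneg by simp
  ultimately show ?case
    using completed_square[OF less.prems] mean_bound by linarith
qed

lemma subconvex: "i < s \<Longrightarrow> subconvex_combination i (q i) x z"
  using q_nonneg q_sum stage_bound by unfold_locales auto

text \<open>The given values attain the bound, so both nonnegative terms of
  \<open>completed_square\<close> vanish. The square fixes \<open>t i\<close>, and equality in
  Jensen concentrates row \<open>i\<close> on its predecessor, which inherits the extremal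
  values.\<close>

lemma tight_stage:
  assumes i: "i < s" and xi: "x i = 2 * (real i + 1)" and zi: "z i = 2 * (real i + 1) * (real i + 2)"
  shows "t i = 2"
    and "j < i \<Longrightarrow> q i j = (if Suc j = i then 1 else 0)"
    and "i = Suc k \<Longrightarrow> x k = 2 * (real k + 1) \<and> z k = 2 * (real k + 1) * (real k + 2)"
proof -
  interpret subconvex_combination i "q i" x z by (rule subconvex[OF i])
  have "z i - growth (Suc i) * (x i)\<^sup>2 = 0"
    using growth_double[of "Suc i"] unfolding xi zi by (simp add: algebra_simps)
  moreover have "0 \<le> growth i * (t i - x i / (real i + 1))\<^sup>2"
    using growth_nonneg by simp
  ultimately have tight: "(\<Sum>j<i. q i j * z j) = growth i * mean\<^sup>2"
    and sq: "growth i * (t i - x i / (real i + 1))\<^sup>2 = 0"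
    using completed_square[OF i] mean_bound by linarith+
  show t: "t i = 2"
  \<comment> \<open>For \<open>i = 0\<close> the factor \<open>growth 0 = 0\<close> makes the
    vanishing square uninformative; the empty sum in the x-recursion gives
    \<open>t 0 = x 0 = 2\<close> instead.\<close>
  proof (cases "i = 0")
    case True
    then show ?thesis using x_rec[OF i] xi by simp
  next
    case False
    then have "t i = x i / (real i + 1)" using sq growth_pos[of i] by simp
    moreover have "real i + 1 \<noteq> 0" by linarith
    ultimately show ?thesis by (metis xi nonzero_mult_div_cancel_right)
  qed
  have mean: "mean = 2 * real i" using x_rec[OF i] xi t by simp
  show q: "q i j = (if Suc j = i then 1 else 0)" if "j < i" for j
    using equality_case[OF _ _ that] tight mean that by simp
  show "x k = 2 * (real k + 1) \<and> z k = 2 * (real k + 1) * (real k + 2)" if k: "i = Suc k"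
  proof -
    have "(\<Sum>j<i. q i j * y j) = y k" for y using q by (simp add: k)
    with mean tight growth_double[of i] show ?thesis by (simp add: k algebra_simps)
  qed
qed

lemma tight_all_stages:
  assumes "x (s - 1) = 2 * real s" "z (s - 1) = 2 * real s * (real s + 1)" and i: "i < s"
  shows "x i = 2 * (real i + 1) \<and> z i = 2 * (real i + 1) * (real i + 2)"
proof -
  have "i \<le> s - 1" using i by simp
  then show ?thesis
  proof (induction i rule: inc_induct)
    case base
    have "real (s - 1) = real s - 1" using i by simp
    then show ?case using assms by (simp add: algebra_simps)
  next
    case (step k)
    then show ?case using tight_stage(3)[of "Suc k" k] i by auto
  qed
qed

text \<open>The weights \<open>2 s w\<close> have mean \<open>2 s\<close>, and
  \<open>growth s * (2 s)^2 = 2 s (s + 1)\<close> is exactly their z-average. Equality in Jensen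
  puts all weight on the last stage, where the downward induction starts.\<close>

lemma extremal:
  assumes w_nonneg: "\<And>j. j < s \<Longrightarrow> w j \<ge> 0" and w_sum: "2 * real s * (\<Sum>j<s. w j) \<le> 1"
    and wx: "(\<Sum>j<s. w j * x j) = 1" and wz: "(\<Sum>j<s. w j * z j) = real s + 1"
  shows "j < s \<Longrightarrow> w j = (if Suc j = s then 1 / (2 * real s) else 0)"
    and "i < s \<Longrightarrow> t i = 2"
    and "i < s \<Longrightarrow> j < i \<Longrightarrow> q i j = (if Suc j = i then 1 else 0)"
proof -
  have s: "s > 0" using wx by (cases s) auto
  interpret subconvex_combination s "\<lambda>j. 2 * real s * w j" x z
    using w_nonneg w_sum stage_bound by unfold_locales (auto simp: sum_distrib_left)
  have scaled: "(\<Sum>j<s. 2 * real s * w j * y j) = 2 * real s * (\<Sum>j<s. w j * y j)" for y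
    by (simp add: sum_distrib_left mult.assoc)
  have mean: "mean = 2 * real s" and tight: "(\<Sum>j<s. 2 * real s * w j * z j) = growth s * mean\<^sup>2"
    unfolding scaled wx wz using growth_double[of s] by simp_all
  have u: "2 * real s * w j = (if Suc j = s then 1 else 0)" if "j < s" for j
    using equality_case[OF _ _ that] mean tight s by simp
  show w: "w j = (if Suc j = s then 1 / (2 * real s) else 0)" if "j < s" for j
    using u[OF that] s by (auto simp: field_simps split: if_splits)
  obtain k where k: "s = Suc k" using s by (cases s) auto
  have last: "(\<Sum>j<s. w j * y j) = y k / (2 * real s)" for y
    using w by (simp add: k del: of_nat_Suc)
  have "x (s - 1) = 2 * real s" "z (s - 1) = 2 * real s * (real s + 1)"
    using wx wz s unfolding last by (simp_all add: k field_simps)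
  note stages = tight_all_stages[OF this]
  show "i < s \<Longrightarrow> t i = 2" and "i < s \<Longrightarrow> j < i \<Longrightarrow> q i j = (if Suc j = i then 1 else 0)"
    using tight_stage(1,2) stages by blast+
qed

end

section \<open>Matrix inverses and triangular matrices\<close>

lemma perturbed_identity_inverse_entry:
  fixes R K :: "real mat"
  assumes R: "R \<in> carrier_mat n n" and K: "K \<in> carrier_mat n n" and "(1\<^sub>m n + R) * K = 1\<^sub>m n"
    and ij: "i < n" "j < n"
  shows "(R * K) $$ (i, j) = (if i = j then 1 else 0) - K $$ (i, j)"
proof -
  have "(1\<^sub>m n + R) * K = K + R * K"
    using R K by (subst add_mult_distrib_mat[of _ n n]) auto
  then have "(1\<^sub>m n :: real mat) $$ (i, j) = (K + R * K) $$ (i, j)" using assms(3) by simp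
  then show ?thesis using R K ij by simp
qed

text \<open>\<open>mat_inverse\<close> is specified through the units of \<open>ring_mat\<close>, so
  the witness from \<open>invertible_mat\<close> is first shown to be square of the right
  size.\<close>

lemma inv_mat_inverse:
  assumes M: "M \<in> carrier_mat n n" and inv: "invertible_mat M"
  shows "inv_mat M \<in> carrier_mat n n" "M * inv_mat M = 1\<^sub>m n" "inv_mat M * M = 1\<^sub>m n"
proof -
  obtain B where B: "M * B = 1\<^sub>m n" "B * M = 1\<^sub>m (dim_row B)"
    using inv M unfolding invertible_mat_def inverts_mat_def by auto
  have "dim_col B = n" using arg_cong[OF B(1), of dim_col] by simp
  moreover have "dim_row B = n" using arg_cong[OF B(2), of dim_col] M by simp
  ultimately have "B \<in> carrier_mat n n" by auto
  with B have "M \<in> Units (ring_mat TYPE(real) n ())"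
    using M unfolding Units_def by (auto simp: ring_mat_simps)
  then have "mat_inverse M \<noteq> None" using mat_inverse(1)[OF M, of "()"] by blast
  then show "inv_mat M \<in> carrier_mat n n" "M * inv_mat M = 1\<^sub>m n" "inv_mat M * M = 1\<^sub>m n"
    using mat_inverse(2)[OF M] unfolding inv_mat_def by auto
qed

lemma inverse_unique_mat:
  fixes M :: "real mat"
  assumes "M \<in> carrier_mat n n" "B \<in> carrier_mat n n" "C \<in> carrier_mat n n"
    and "B * M = 1\<^sub>m n" "M * C = 1\<^sub>m n"
  shows "B = C"
  using assms by (metis assoc_mult_mat left_mult_one_mat right_mult_one_mat)

lemma mult_mat_index_sum:
  assumes "M \<in> carrier_mat n n" "B \<in> carrier_mat n n" "i < n" "j < n"
  shows "(M * B) $$ (i, j) = (\<Sum>k<n. M $$ (i, k) * B $$ (k, j))"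
  using assms by (simp add: scalar_prod_def atLeast0LessThan)

lemma mult_mat_vec_index_sum:
  assumes "M \<in> carrier_mat n n" "v \<in> carrier_vec n" "i < n"
  shows "(M *\<^sub>v v) $ i = (\<Sum>k<n. M $$ (i, k) * v $ k)"
  using assms by (simp add: scalar_prod_def atLeast0LessThan)

lemma sum_lessThan_triangular:
  fixes g :: "nat \<Rightarrow> 'a::comm_monoid_add"
  assumes "i < n" "\<And>k. i < k \<Longrightarrow> k < n \<Longrightarrow> g k = 0"
  shows "(\<Sum>k<n. g k) = (\<Sum>k<i. g k) + g i"
proof -
  have "(\<Sum>k<n. g k) = (\<Sum>k<Suc i. g k)"
    using assms by (intro sum.mono_neutral_right) auto
  then show ?thesis by simp
qed

text \<open>The determinant is the product of the diagonal, so no diagonal entry of \<open>M\<close>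
  vanishes; forward substitution in \<open>M * K = 1\<close> then clears the entries of
  \<open>K\<close> above the diagonal.\<close>

lemma lower_triangular_inverse:
  fixes M K :: "real mat"
  assumes M: "M \<in> carrier_mat n n" and K: "K \<in> carrier_mat n n" and MK: "M * K = 1\<^sub>m n"
    and tri: "\<And>i j. i < j \<Longrightarrow> j < n \<Longrightarrow> M $$ (i, j) = 0"
  shows "i < n \<Longrightarrow> M $$ (i, i) * K $$ (i, i) = 1"
    and "i < j \<Longrightarrow> j < n \<Longrightarrow> K $$ (i, j) = 0"
proof -
  have "det M * det K = 1" using det_mult[OF M K] MK by simp
  then have "prod_list (diag_mat M) \<noteq> 0" using det_lower_triangular[OF tri M]
    by (metis mult_zero_left zero_neq_one)
  then have diag: "M $$ (i, i) \<noteq> 0" if "i < n" for i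
    using that M by (auto simp: diag_mat_def prod_list_zero_iff image_iff)
  have entry: "(\<Sum>k<i. M $$ (i, k) * K $$ (k, j)) + M $$ (i, i) * K $$ (i, j) = (if i = j then 1 else 0)"
    if "i < n" "j < n" for i j
    using mult_mat_index_sum[OF M K that] MK that tri
      sum_lessThan_triangular[of i n "\<lambda>k. M $$ (i, k) * K $$ (k, j)"] by simp
  have upper: "i < j \<longrightarrow> j < n \<longrightarrow> K $$ (i, j) = 0" for i j
  proof (induction i rule: less_induct)
    case (less i)
    show ?case
    proof (intro impI)
      assume "i < j" "j < n"
      with less entry[of i j] diag[of i] show "K $$ (i, j) = 0" by simp
    qed
  qed
  then show "i < j \<Longrightarrow> j < n \<Longrightarrow> K $$ (i, j) = 0" by blast
  show "M $$ (i, i) * K $$ (i, i) = 1" if "i < n" using entry[OF that that] upper that by simp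
qed

section \<open>Necessity: admissibility determines the inverse and the transformed weights\<close>

definition K_opt :: "nat \<Rightarrow> real mat" where
  "K_opt s = mat s s (\<lambda>(i, j). if j = i then 1 / 2 else if Suc j = i then - 1 / 2 else 0)"

text \<open>This is \<open>K_opt^T b_opt\<close>: the columns of the bidiagonal \<open>K_opt\<close>
  sum to 0, except the last, which sums to 1/2.\<close>

definition w_opt :: "nat \<Rightarrow> real vec" where
  "w_opt s = vec s (\<lambda>j. if Suc j = s then 1 / (2 * real s) else 0)"

lemma opt_carrier [simp]:
  "A_opt s \<in> carrier_mat s s" "b_opt s \<in> carrier_vec s"
  "K_opt s \<in> carrier_mat s s" "w_opt s \<in> carrier_vec s" "ones_vec s \<in> carrier_vec s"
  by (simp_all add: A_opt_def b_opt_def K_opt_def w_opt_def ones_vec_def)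

lemma opt_dim [simp]:
  "dim_row (A_opt s) = s" "dim_col (A_opt s) = s" "dim_row (K_opt s) = s" "dim_col (K_opt s) = s"
  by (simp_all add: A_opt_def K_opt_def)

lemma admissible_inverse_opt:
  assumes adm: "admissible s A b"
  defines "M \<equiv> 1\<^sub>m s + (2 * real s) \<cdot>\<^sub>m A"
  shows "inv_mat M = K_opt s" "transpose_mat (inv_mat M) *\<^sub>v b = w_opt s"
proof -
  define K where "K = inv_mat M"
  define e where "e = ones_vec s"
  define x where "x = M *\<^sub>v e"
  define z where "z = M *\<^sub>v x"
  define w where "w = transpose_mat K *\<^sub>v b"
  from adm have A: "A \<in> carrier_mat s s" and b: "b \<in> carrier_vec s"
    and tri: "lower_triangular_mat A" and be: "b \<bullet> e = 1" and bAe: "b \<bullet> (A *\<^sub>v e) = 1 / 2"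
    and inv: "invertible_mat M" and Ke: "0\<^sub>v s \<le> K *\<^sub>v e"
    and P: "0\<^sub>m s s \<le> ((2 * real s) \<cdot>\<^sub>m A) * K" and w0: "0\<^sub>v s \<le> w"
    and ws: "0 \<le> 1 - 2 * real s * (b \<bullet> (K *\<^sub>v e))"
    unfolding admissible_def order_two_def monotonicity_conditions_def Let_def
      e_def K_def M_def w_def by auto
  have M: "M \<in> carrier_mat s s" using A by (simp add: M_def)
  have K: "K \<in> carrier_mat s s" and MK: "M * K = 1\<^sub>m s" and KM: "K * M = 1\<^sub>m s"
    using inv_mat_inverse[OF M inv] by (simp_all add: K_def)
  have e: "e \<in> carrier_vec s" by (simp add: e_def)
  have x: "x \<in> carrier_vec s" and z: "z \<in> carrier_vec s" and w: "w \<in> carrier_vec s"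
    using M K e b by (auto simp: x_def z_def w_def)
  have Kx: "K *\<^sub>v x = e" and Kz: "K *\<^sub>v z = x"
    using assoc_mult_mat_vec[OF K M e] assoc_mult_mat_vec[OF K M x] KM e x
    by (simp_all add: x_def z_def)
  have M_tri: "M $$ (i, j) = 0" if "i < j" "j < s" for i j
    using that tri A by (auto simp: M_def lower_triangular_mat_def)
  have K_diag: "M $$ (i, i) * K $$ (i, i) = 1" if "i < s" for i
    using lower_triangular_inverse(1)[OF M K MK M_tri] that by blast
  have K_upper: "K $$ (i, j) = 0" if "i < j" "j < s" for i j
    using lower_triangular_inverse(2)[OF M K MK M_tri] that by blast
  \<comment> \<open>With \<open>R = 2 s A\<close>, the identity \<open>R K = I - K\<close> turns the
    sign condition on \<open>R K\<close> into nonpositive off-diagonal entries of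
    \<open>K\<close>.\<close>
  have K_off: "K $$ (i, j) \<le> 0" if "i < s" "j < i" for i j
  proof -
    have "0 \<le> (((2 * real s) \<cdot>\<^sub>m A) * K) $$ (i, j)"
      using P A K that by (auto simp: less_eq_mat_def)
    moreover have "(((2 * real s) \<cdot>\<^sub>m A) * K) $$ (i, j) = - K $$ (i, j)"
      using perturbed_identity_inverse_entry[of "(2 * real s) \<cdot>\<^sub>m A" s K i j]
        MK A K that unfolding M_def by simp
    ultimately show ?thesis by linarith
  qed
  have row: "(K *\<^sub>v v) $ i = (\<Sum>j<i. K $$ (i, j) * v $ j) + K $$ (i, i) * v $ i"
    if "v \<in> carrier_vec s" "i < s" for v i
    using mult_mat_vec_index_sum[OF K that] K_upper that
      sum_lessThan_triangular[of i s "\<lambda>j. K $$ (i, j) * v $ j"] by simp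
  have row_sum: "0 \<le> (\<Sum>j<i. K $$ (i, j)) + K $$ (i, i)" if "i < s" for i
  proof -
    have "0 \<le> (K *\<^sub>v e) $ i" using Ke that K by (auto simp: less_eq_vec_def)
    with row[OF e that] that show ?thesis
      by (simp add: e_def ones_vec_def del: index_mult_mat_vec)
  qed
  \<comment> \<open>Nonpositive off-diagonal entries and a nonnegative row sum make the diagonal
    entry nonnegative; invertibility excludes 0.\<close>
  have K_pos: "K $$ (i, i) > 0" if "i < s" for i
  proof -
    have "(\<Sum>j<i. K $$ (i, j)) \<le> 0" using K_off that by (intro sum_nonpos) auto
    moreover have "K $$ (i, i) \<noteq> 0" using K_diag[OF that] by auto
    ultimately show ?thesis using row_sum[OF that] by linarith
  qed
  have row_div: "v $ i = (K *\<^sub>v v) $ i / K $$ (i, i) + (\<Sum>j<i. (- K $$ (i, j) / K $$ (i, i)) * v $ j)"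
    if "v \<in> carrier_vec s" "i < s" for v i
  proof -
    have "(\<Sum>j<i. (- K $$ (i, j) / K $$ (i, i)) * v $ j) = - (\<Sum>j<i. K $$ (i, j) * v $ j) / K $$ (i, i)"
      by (simp add: sum_divide_distrib sum_negf)
    then show ?thesis using row[OF that] K_pos[OF that(2)] by (simp add: field_simps)
  qed
  interpret stage_recursion s "\<lambda>i j. - K $$ (i, j) / K $$ (i, i)" "\<lambda>i. 1 / K $$ (i, i)"
    "\<lambda>i. x $ i" "\<lambda>i. z $ i"
  proof
    fix i assume i: "i < s"
    show "0 \<le> - K $$ (i, j) / K $$ (i, i)" if "j < i" for j
      using K_off[OF i that] K_pos[OF i] by (simp add: divide_nonpos_pos)
    have scaled: "(\<Sum>j<i. - K $$ (i, j) / K $$ (i, i)) = - (\<Sum>j<i. K $$ (i, j)) / K $$ (i, i)"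
      by (simp add: sum_divide_distrib sum_negf)
    show "(\<Sum>j<i. - K $$ (i, j) / K $$ (i, i)) \<le> 1"
      unfolding scaled using row_sum[OF i] K_pos[OF i] by (simp add: field_simps)
    show "0 < 1 / K $$ (i, i)" using K_pos[OF i] by simp
    show "x $ i = 1 / K $$ (i, i) + (\<Sum>j<i. - K $$ (i, j) / K $$ (i, i) * x $ j)"
      using row_div[OF x i] i by (simp add: Kx) (simp add: e_def ones_vec_def)
    show "z $ i = 1 / K $$ (i, i) * x $ i + (\<Sum>j<i. - K $$ (i, j) / K $$ (i, i) * z $ j)"
      using row_div[OF z i] by (simp add: Kz)
  qed
  \<comment> \<open>Moving \<open>K\<close> across the scalar product reduces the sums with
    \<open>x\<close> and \<open>z\<close> to \<open>b \<bullet> e\<close> and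
    \<open>b \<bullet> x\<close>, hence to the order conditions.\<close>
  have w_prod: "(\<Sum>j<s. w $ j * v $ j) = b \<bullet> (K *\<^sub>v v)" if "v \<in> carrier_vec s" for v
    using transpose_vec_mult_scalar[OF K that b] that
    by (simp add: w_def scalar_prod_def atLeast0LessThan)
  have "((2 * real s) \<cdot>\<^sub>m A) *\<^sub>v e = (2 * real s) \<cdot>\<^sub>v (A *\<^sub>v e)"
    using A e by (intro eq_vecI) auto
  then have "x = e + (2 * real s) \<cdot>\<^sub>v (A *\<^sub>v e)"
    unfolding x_def M_def using A e
    by (simp add: add_mult_distrib_mat_vec[of _ s s])
  then have bx: "b \<bullet> x = real s + 1"
    using b e A be bAe by (simp add: scalar_prod_add_distrib[of _ s])
  have "2 * real s * (\<Sum>j<s. w $ j) \<le> 1"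
    using w_prod[OF e] ws by (simp add: e_def ones_vec_def)
  note ext = extremal[of "\<lambda>j. w $ j", OF _ this, unfolded w_prod[OF x] w_prod[OF z] Kx Kz, OF _ be bx]
  have w_nonneg: "w $ j \<ge> 0" if "j < s" for j
    using w0 that by (auto simp: less_eq_vec_def w_def)
  have "w = w_opt s"
    using w ext(1)[OF w_nonneg] by (intro eq_vecI) (auto simp: w_opt_def)
  then show "transpose_mat (inv_mat M) *\<^sub>v b = w_opt s" by (simp add: w_def K_def)
  have d: "K $$ (i, i) = 1 / 2" if "i < s" for i
    using ext(2)[OF w_nonneg that] K_pos[OF that] by (simp add: field_simps)
  have lower: "K $$ (i, j) = (if Suc j = i then - 1 / 2 else 0)" if "i < s" "j < i" for i j
    using ext(3)[OF w_nonneg that, unfolded d[OF that(1)]] by (auto split: if_splits)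
  have "K $$ (i, j) = K_opt s $$ (i, j)" if "i < s" "j < s" for i j
    using that d lower[of i j] K_upper[of i j]
    by (cases i j rule: linorder_cases) (simp_all add: K_opt_def)
  then show "inv_mat M = K_opt s"
    unfolding K_def[symmetric] using K by (intro eq_matI) (auto simp: K_opt_def)
qed

section \<open>Admissibility and uniqueness of the optimal pair\<close>

lemma M_opt_K_opt:
  assumes "s \<ge> 1"
  shows "(1\<^sub>m s + (2 * real s) \<cdot>\<^sub>m A_opt s) * K_opt s = 1\<^sub>m s" (is "?M * _ = _")
proof (rule eq_matI)
  have M: "?M \<in> carrier_mat s s" by simp
  have entry: "?M $$ (i, j) = (if j \<le> i then 2 else 0)" if "i < s" "j < s" for i j
    using that by (auto simp: A_opt_def)
  fix i j assume "i < dim_row (1\<^sub>m s :: real mat)" "j < dim_col (1\<^sub>m s :: real mat)"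
  then have i: "i < s" and j: "j < s" by simp_all
  have "(?M * K_opt s) $$ (i, j) = (\<Sum>k<s. (if k \<le> i then 2 else 0) * K_opt s $$ (k, j))"
    using mult_mat_index_sum[OF M _ i j] entry i by simp
  \<comment> \<open>\<open>?M\<close> is twice the summation matrix and \<open>K_opt\<close> half
    the backward difference, so the sum collapses to two indicators, of \<open>j \<le> i\<close> and
    of \<open>Suc j \<le> i\<close>. If \<open>Suc j = s\<close>, the second delta is out of range,
    in agreement with \<open>i < s\<close>.\<close>
  also have "\<dots> = (\<Sum>k<s. (if k = j then (if k \<le> i then 1 else 0) else 0)
      - (if k = Suc j then (if k \<le> i then 1 else 0) else 0))"
    using j by (intro sum.cong) (auto simp: K_opt_def)
  also have "\<dots> = 1\<^sub>m s $$ (i, j)"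
    using i j by (auto simp: sum_subtractf)
  finally show "(?M * K_opt s) $$ (i, j) = 1\<^sub>m s $$ (i, j)" .
qed (simp_all add: A_opt_def K_opt_def)

lemma A_opt_row_sum:
  fixes g :: "nat \<Rightarrow> 'v::real_vector"
  assumes i: "i < s"
  shows "(\<Sum>j<s. A_opt s $$ (i, j) *\<^sub>R g j)
    = (1 / real s) *\<^sub>R (\<Sum>j<i. g j) + (1 / (2 * real s)) *\<^sub>R g i"
proof -
  have "(\<Sum>j<s. A_opt s $$ (i, j) *\<^sub>R g j)
      = (\<Sum>j<i. A_opt s $$ (i, j) *\<^sub>R g j) + A_opt s $$ (i, i) *\<^sub>R g i"
    using i by (intro sum_lessThan_triangular) (auto simp: A_opt_def)
  also have "\<dots> = (\<Sum>j<i. (1 / real s) *\<^sub>R g j) + (1 / (2 * real s)) *\<^sub>R g i"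
    using i by (simp add: A_opt_def)
  finally show ?thesis by (simp add: scaleR_right.sum)
qed

lemma b_opt_sum:
  fixes g :: "nat \<Rightarrow> 'v::real_vector"
  shows "(\<Sum>j<s. b_opt s $ j *\<^sub>R g j) = (1 / real s) *\<^sub>R (\<Sum>j<s. g j)"
  by (simp add: b_opt_def scaleR_right.sum)

lemma admissible_opt:
  assumes s: "s \<ge> 1"
  shows "admissible s (A_opt s) (b_opt s)"
proof -
  define M where "M = 1\<^sub>m s + (2 * real s) \<cdot>\<^sub>m A_opt s"
  have M: "M \<in> carrier_mat s s" by (simp add: M_def)
  have MK: "M * K_opt s = 1\<^sub>m s" using M_opt_K_opt[OF s] by (simp add: M_def)
  have KM: "K_opt s * M = 1\<^sub>m s" by (rule mat_mult_left_right_inverse[OF M _ MK]) simp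
  have inv: "invertible_mat M"
    unfolding invertible_mat_def inverts_mat_def using M MK KM
    by (metis carrier_matD opt_carrier(3) square_mat.simps)
  have K: "inv_mat M = K_opt s"
    using inverse_unique_mat[OF M _ _ _ MK] inv_mat_inverse[OF M inv] by simp
  have K_entry: "K_opt s $$ (i, j) = (if j = i then 1 / 2 else 0) - (if Suc j = i then 1 / 2 else 0)"
    if "i < s" "j < s" for i j
    using that by (simp add: K_opt_def)
  have A_row: "(A_opt s *\<^sub>v ones_vec s) $ i = (2 * real i + 1) / (2 * real s)" if "i < s" for i
    using mult_mat_vec_index_sum[of "A_opt s" s "ones_vec s" i] A_opt_row_sum[OF that, of "\<lambda>_. 1 :: real"]
      that by (simp add: ones_vec_def field_simps)
  \<comment> \<open>The second order condition is the sum of the first \<open>s\<close> odd numbers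
    divided by \<open>2 s^2\<close>.\<close>
  have odd_sum: "(\<Sum>i<n. 2 * real i + 1) = (real n)\<^sup>2" for n
    by (induction n) (simp_all add: power2_eq_square algebra_simps)
  have "b_opt s \<bullet> (A_opt s *\<^sub>v ones_vec s) = (\<Sum>i<s. (2 * real i + 1) / (2 * real s * real s))"
    unfolding scalar_prod_def atLeast0LessThan using A_row
    by (intro sum.cong) (simp_all add: b_opt_def mult_ac del: index_mult_mat_vec)
  also have "\<dots> = 1 / 2"
    using s odd_sum[of s] by (simp add: power2_eq_square flip: sum_divide_distrib)
  finally have bA: "b_opt s \<bullet> (A_opt s *\<^sub>v ones_vec s) = 1 / 2" .
  have be: "b_opt s \<bullet> ones_vec s = 1"
    using s by (simp add: scalar_prod_def b_opt_def ones_vec_def)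
  have Ke: "K_opt s *\<^sub>v ones_vec s = vec s (\<lambda>i. if i = 0 then 1 / 2 else 0)"
  proof (rule eq_vecI)
    fix i assume "i < dim_vec (vec s (\<lambda>i. if i = 0 then 1 / 2 else 0 :: real))"
    then have i: "i < s" by simp
    have "(K_opt s *\<^sub>v ones_vec s) $ i
        = (\<Sum>j<s. (if j = i then 1 / 2 else 0) - (if Suc j = i then 1 / 2 else 0))"
      using mult_mat_vec_index_sum[of "K_opt s" s "ones_vec s" i] K_entry i by (simp add: ones_vec_def)
    also have "\<dots> = (if i = 0 then 1 / 2 else 0)"
      using i by (cases i) (simp_all add: sum_subtractf)
    finally show "(K_opt s *\<^sub>v ones_vec s) $ i = vec s (\<lambda>i. if i = 0 then 1 / 2 else 0) $ i"
      using i by simp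
  qed (simp add: K_opt_def)
  have "0\<^sub>m s s \<le> ((2 * real s) \<cdot>\<^sub>m A_opt s) * K_opt s"
    using perturbed_identity_inverse_entry[of "(2 * real s) \<cdot>\<^sub>m A_opt s" s "K_opt s"] MK
    by (simp add: less_eq_mat_def M_def K_entry del: index_mult_mat(1))
  moreover have "0\<^sub>v s \<le> transpose_mat (K_opt s) *\<^sub>v b_opt s"
  proof -
    have "0 \<le> (transpose_mat (K_opt s) *\<^sub>v b_opt s) $ j" if j: "j < s" for j
    proof -
      have "(transpose_mat (K_opt s) *\<^sub>v b_opt s) $ j = (\<Sum>i<s. K_opt s $$ (i, j) / real s)"
        using mult_mat_vec_index_sum[of "transpose_mat (K_opt s)" s "b_opt s" j] j
        by (simp add: b_opt_def K_opt_def)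
      also have "\<dots> = (\<Sum>i<s. (if i = j then 1 / 2 else 0) - (if i = Suc j then 1 / 2 else 0)) / real s"
        using K_entry j by (simp add: sum_divide_distrib eq_commute)
      also have "\<dots> \<ge> 0"
        using j by (simp add: sum_subtractf)
      finally show ?thesis .
    qed
    then show ?thesis by (simp add: less_eq_vec_def K_opt_def)
  qed
  \<comment> \<open>With \<open>r = 2 s\<close> the last monotonicity condition therefore holds with
    equality.\<close>
  moreover have "b_opt s \<bullet> (K_opt s *\<^sub>v ones_vec s) = 1 / (2 * real s)"
    using s by (simp add: Ke scalar_prod_def b_opt_def if_distrib cong: if_cong)
  ultimately have "monotonicity_conditions s (2 * real s) (A_opt s) (b_opt s)"
    unfolding monotonicity_conditions_def Let_def M_def[symmetric] K
    using inv s by (simp add: Ke less_eq_vec_def)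
  with be bA show ?thesis
    by (auto simp: admissible_def order_two_def lower_triangular_mat_def A_opt_def[of s])
qed

text \<open>Any admissible pair shares its inverse and transformed weights with the optimal pair,
  itself admissible. Inverting \<open>K_opt\<close> recovers \<open>A\<close>, and inverting its
  transpose recovers \<open>b\<close>.\<close>

lemma admissible_unique:
  assumes s: "s \<ge> 1" and adm: "admissible s A b"
  shows "A = A_opt s" "b = b_opt s"
proof -
  define M where "M B = 1\<^sub>m s + (2 * real s) \<cdot>\<^sub>m B" for B
  have carrier: "B \<in> carrier_mat s s \<and> c \<in> carrier_vec s \<and> M B \<in> carrier_mat s s \<and>
      K_opt s * M B = 1\<^sub>m s \<and> M B * K_opt s = 1\<^sub>m s \<and> transpose_mat (K_opt s) *\<^sub>v c = w_opt s"
    if "admissible s B c" for B c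
  proof -
    have B: "B \<in> carrier_mat s s" "c \<in> carrier_vec s" "invertible_mat (M B)"
      using that unfolding admissible_def monotonicity_conditions_def Let_def M_def by auto
    then have "M B \<in> carrier_mat s s" by (simp add: M_def)
    with B inv_mat_inverse[OF this B(3)] admissible_inverse_opt[OF that] show ?thesis
      by (simp add: M_def)
  qed
  note this_A = carrier[OF adm] and this_opt = carrier[OF admissible_opt[OF s]]
  have eq: "M A = M (A_opt s)"
    using inverse_unique_mat[of "K_opt s" s "M A" "M (A_opt s)"] this_A this_opt by simp
  show "A = A_opt s"
  proof (rule eq_matI)
    fix i j assume "i < dim_row (A_opt s)" "j < dim_col (A_opt s)"
    then have "i < s" "j < s" by (simp_all add: A_opt_def)
    then show "A $$ (i, j) = A_opt s $$ (i, j)"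
      using arg_cong[OF eq, of "\<lambda>B. B $$ (i, j)"] s carrier_matD[of A s s] this_A
      by (simp add: M_def)
  qed (use this_A this_opt in auto)
  have "c = transpose_mat (M A) *\<^sub>v (transpose_mat (K_opt s) *\<^sub>v c)" if "c \<in> carrier_vec s" for c
  proof -
    have "transpose_mat (M A) * transpose_mat (K_opt s) = 1\<^sub>m s"
      using transpose_mult[of "K_opt s" s s "M A" s] this_A by simp
    then show ?thesis
      using assoc_mult_mat_vec[of "transpose_mat (M A)" s s "transpose_mat (K_opt s)" s c] that this_A
      by simp
  qed
  from this[of b] this[of "b_opt s"] show "b = b_opt s" using this_A this_opt by simp
qed

section \<open>Identification with the iterated implicit midpoint rule\<close>

lemma rk_step_opt:
  fixes f :: "'v::real_vector \<Rightarrow> 'v"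
  shows "rk_step s (A_opt s) (b_opt s) f \<tau> = (midpoint_step f (\<tau> / real s)) ^^ s"
proof (intro ext iffI)
  fix U U' :: 'v
  let ?h = "\<tau> / real s"
  \<comment> \<open>The value after \<open>i\<close> midpoint substeps. The Runge-Kutta stages are
    the midpoint stages, so both directions hold as relations, without solvability assumptions on
    \<open>f\<close>.\<close>
  let ?G = "\<lambda>y i. U + ?h *\<^sub>R (\<Sum>j<i. f (y j))"
  have stage: "U + \<tau> *\<^sub>R (\<Sum>j<s. A_opt s $$ (i, j) *\<^sub>R f (y j)) = ?G y i + (?h / 2) *\<^sub>R f (y i)"
    if "i < s" for i y
    using A_opt_row_sum[OF that, of "\<lambda>j. f (y j)"] by (simp add: scaleR_add_right mult.commute)
  have final: "U + \<tau> *\<^sub>R (\<Sum>j<s. b_opt s $ j *\<^sub>R f (y j)) = ?G y s" for y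
    by (simp add: b_opt_sum)
  show "(midpoint_step f ?h ^^ s) U U'" if "rk_step s (A_opt s) (b_opt s) f \<tau> U U'"
  proof -
    from that obtain y where y: "\<forall>i<s. y i = ?G y i + (?h / 2) *\<^sub>R f (y i)" and U': "U' = ?G y s"
      unfolding rk_step_def using stage final by auto
    have "midpoint_step f ?h (?G y i) (?G y (Suc i))" if "i < s" for i
      unfolding midpoint_step_def using y that
      by (intro exI[of _ "y i"]) (simp add: scaleR_add_right)
    then show ?thesis
      unfolding relpowp_fun_conv using U' by (intro exI[of _ "?G y"]) auto
  qed
  show "rk_step s (A_opt s) (b_opt s) f \<tau> U U'" if "(midpoint_step f ?h ^^ s) U U'"
  proof -
    from that obtain g where g: "g 0 = U" "g s = U'" "\<forall>i<s. midpoint_step f ?h (g i) (g (Suc i))"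
      unfolding relpowp_fun_conv by auto
    \<comment> \<open>One midpoint stage is chosen for each substep of the chain \<open>g\<close>;
      together they form the Runge-Kutta stage vector.\<close>
    then obtain y where y: "\<And>i. i < s \<Longrightarrow> y i = g i + (?h / 2) *\<^sub>R f (y i)"
      and step: "\<And>i. i < s \<Longrightarrow> g (Suc i) = g i + ?h *\<^sub>R f (y i)"
      unfolding midpoint_step_def by metis
    have g_eq: "i \<le> s \<Longrightarrow> g i = ?G y i" for i
      by (induction i) (simp_all add: g(1) step scaleR_add_right)
    show ?thesis
      unfolding rk_step_def
    proof (intro exI[of _ y] conjI allI impI)
      show "y i = U + \<tau> *\<^sub>R (\<Sum>j<s. A_opt s $$ (i, j) *\<^sub>R f (y j))" if "i < s" for i
        unfolding stage[OF that] g_eq[OF less_imp_le[OF that], symmetric] by (rule y[OF that])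
      show "U' = U + \<tau> *\<^sub>R (\<Sum>j<s. b_opt s $ j *\<^sub>R f (y j))"
        unfolding final g_eq[OF le_refl, symmetric] by (rule g(2)[symmetric])
    qed
  qed
qed

theorem mainTheorem2:
  fixes s :: nat and f :: "'v::real_vector \<Rightarrow> 'v" and \<tau> :: real
  assumes "s \<ge> 1"
  shows "admissible s (A_opt s) (b_opt s)
    \<and> (\<forall>A b. admissible s A b \<longrightarrow> A = A_opt s \<and> b = b_opt s)
    \<and> rk_step s (A_opt s) (b_opt s) f \<tau> = (midpoint_step f (\<tau> / real s)) ^^ s"
  using admissible_opt[OF assms] admissible_unique[OF assms] rk_step_opt by blast

end
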